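(* Suppose that $(\bar A,\bar b)$, $\bar A\in\{0,*\}^{n\times n}$, $\bar b\in\{0,*\}^{n\times1}$, is structurally controllable, and that $\bar F\in\{0,*\}^{n\times(n+1)}$ has only one nonzero entry, at position $(i,j)$. Then $i\in{\cal I}_j^*$ if and only if the maximum size over all path-cycle families in ${\cal G}(\bar A,\bar b)-{\cal E}^{\rm out}_{x_j}$ and the maximum size over all path-cycle families in ${\cal G}(\bar A,\bar b)-({\cal E}^{\rm out}_{x_j}\cup{\cal E}^{\rm in}_{x_i})$ both equal $n-1$.
   Context: ${\cal J}_p=\{1,\dots,p\}$; $M[{\cal I}_1,{\cal I}_2]$ is the submatrix with rows ${\cal I}_1$ and columns ${\cal I}_2$. A structured matrix has entries in $\{0,*\}$; its realizations are the complex matrices vanishing wherever it has a $0$ entry; ${\rm grank}$ is the maximum rank over all realizations. $(A,b)$ is controllable if $[b,Ab,\dots,A^{n-1}b]$ has rank $n$; $(\bar A,\bar b)$ is structurally controllable if it has a controllable realization. Let $\bar H=[\bar A,\bar b]$, $r_j={\rm grank}(\bar H[{\cal J}_n,{\cal J}_{n+1}\backslash\{j\}])$, ${\cal I}_j=\{{\cal I}\subseteq{\cal J}_n:{\rm grank}(\bar H[{\cal I},{\cal J}_{n+1}\backslash\{j\}])=r_j,\ |{\cal I}|=r_j\}$, and ${\cal I}_j^*=\bigcup_{w\in{\cal I}_j}({\cal J}_n\backslash w)$. ${\cal G}(\bar A,\bar b)$ is the directed graph with vertices $x_1,\dots,x_n$ (states), $x_{n+1}$ (input), edges $(x_k,x_l)$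 with $\bar A_{lk}\neq0$ and $(x_{n+1},x_l)$ with $\bar b_l\neq0$. ${\cal E}_{x}^{\rm in}$, ${\cal E}_x^{\rm out}$ are the sets of edges of this graph entering, respectively leaving, $x$. ${\cal G}-{\cal E}_s$ is ${\cal G}$ with the edges ${\cal E}_s$ deleted. A path family (resp. cycle family) is a collection of vertex-disjoint elementary paths (resp. cycles); a path-cycle family is a union of a path family and a cycle family that are vertex-disjoint; its size is the number of edges it contains. *)

theory Defs
  imports "Jordan_Normal_Form.DL_Rank" "Jordan_Normal_Form.DL_Submatrix"
    "Graph_Theory.Digraph" "Graph_Theory.Arc_Walk" "Graph_Theory.Pair_Digraph"
begin

(* Rows, columns and vertices are numbered from 0, as in Matrix: the index set {1..p} becomes
   {..<p}, the states x_1, ..., x_n become 0, ..., n - 1, and the input x_(n+1) becomes n. *)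

section \<open>Structured matrices and generic rank\<close>

datatype entry = Zero | Star

definition mat_rank :: "complex mat \<Rightarrow> nat" where
  "mat_rank M = vec_space.rank (dim_row M) M"

definition realizations :: "entry mat \<Rightarrow> complex mat set" where
  "realizations S = {M \<in> carrier_mat (dim_row S) (dim_col S).
     \<forall>k < dim_row S. \<forall>l < dim_col S. S $$ (k, l) = Zero \<longrightarrow> M $$ (k, l) = 0}"

definition grank :: "entry mat \<Rightarrow> nat" where
  "grank S = Max (mat_rank ` realizations S)"

text \<open>The maximum is over a finite nonempty set.\<close>

lemma finite_mat_rank_realizations: "finite (mat_rank ` realizations S)"
proof (rule finite_subset)
  show "mat_rank ` realizations S \<subseteq> {..dim_col S}"
    by (auto simp: mat_rank_def realizations_def intro: vec_space.rank_le_nc)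
qed simp

lemma realizations_nonempty: "realizations S \<noteq> {}"
proof -
  have "0\<^sub>m (dim_row S) (dim_col S) \<in> realizations S"
    by (simp add: realizations_def)
  then show ?thesis by blast
qed


section \<open>Structural controllability\<close>

definition controllability_matrix :: "complex mat \<Rightarrow> complex mat \<Rightarrow> complex mat" where
  "controllability_matrix A b =
     mat (dim_row A) (dim_row A) (\<lambda>(k, l). ((A ^\<^sub>m l) * b) $$ (k, 0))"

definition controllable :: "complex mat \<Rightarrow> complex mat \<Rightarrow> bool" where
  "controllable A b \<longleftrightarrow> mat_rank (controllability_matrix A b) = dim_row A"

definition structurally_controllable :: "entry mat \<Rightarrow> entry mat \<Rightarrow> bool" where
  "structurally_controllable A b \<longleftrightarrow>
     (\<exists>A' \<in> realizations A. \<exists>b' \<in> realizations b. controllable A' b')"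


section \<open>The index sets determined by \<open>H = [A, b]\<close>\<close>

definition sys_mat :: "entry mat \<Rightarrow> entry mat \<Rightarrow> entry mat" where
  "sys_mat A b = mat (dim_row A) (dim_col A + 1)
     (\<lambda>(k, l). if l < dim_col A then A $$ (k, l) else b $$ (k, 0))"

definition col_del_grank :: "entry mat \<Rightarrow> entry mat \<Rightarrow> nat \<Rightarrow> nat" where
  "col_del_grank A b j =
     grank (submatrix (sys_mat A b) {..<dim_row A} ({..<dim_col A + 1} - {j}))"

definition row_bases :: "entry mat \<Rightarrow> entry mat \<Rightarrow> nat \<Rightarrow> nat set set" where
  "row_bases A b j = {I. I \<subseteq> {..<dim_row A} \<and>
     grank (submatrix (sys_mat A b) I ({..<dim_col A + 1} - {j})) = col_del_grank A b j \<and>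
     card I = col_del_grank A b j}"

definition row_bases_star :: "entry mat \<Rightarrow> entry mat \<Rightarrow> nat \<Rightarrow> nat set" where
  "row_bases_star A b j = (\<Union>w \<in> row_bases A b j. {..<dim_row A} - w)"


section \<open>The system digraph\<close>

(* An arc (k, l) leads from k to l, so it comes from the entry in row l and column k. *)
definition sys_graph :: "entry mat \<Rightarrow> entry mat \<Rightarrow> (nat, nat \<times> nat) pre_digraph" where
  "sys_graph A b = with_proj
     \<lparr>pverts = {..dim_row A},
      parcs = {(k, l). k < dim_row A \<and> l < dim_row A \<and> A $$ (l, k) \<noteq> Zero}
            \<union> {(dim_row A, l) | l. l < dim_row A \<and> b $$ (l, 0) \<noteq> Zero}\<rparr>"

definition del_arcs :: "('a, 'b) pre_digraph \<Rightarrow> 'b set \<Rightarrow> ('a, 'b) pre_digraph" where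
  "del_arcs G E = G\<lparr>arcs := arcs G - E\<rparr>"


section \<open>Path-cycle families\<close>

(* A path is given by its start vertex and its list of arcs; the start vertex matters only for
   paths without arcs. Cycles are those of Arc_Walk, so a self-loop is a cycle of length 1. *)

definition path_verts :: "('a, 'b) pre_digraph \<Rightarrow> 'a \<times> 'b list \<Rightarrow> 'a set" where
  "path_verts G = (\<lambda>(u, p). set (pre_digraph.awalk_verts G u p))"

definition cycle_verts :: "('a, 'b) pre_digraph \<Rightarrow> 'b list \<Rightarrow> 'a set" where
  "cycle_verts G c = set (pre_digraph.awalk_verts G (tail G (hd c)) c)"

definition path_family :: "('a, 'b) pre_digraph \<Rightarrow> ('a \<times> 'b list) set \<Rightarrow> bool" where
  "path_family G P \<longleftrightarrow> (\<forall>(u, p) \<in> P. \<exists>v. pre_digraph.apath G u p v) \<and>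
     pairwise (\<lambda>p q. path_verts G p \<inter> path_verts G q = {}) P"

(* Two rotations of the same cycle share vertices, so at most one of them is in a family. *)
definition cycle_family :: "('a, 'b) pre_digraph \<Rightarrow> 'b list set \<Rightarrow> bool" where
  "cycle_family G C \<longleftrightarrow> (\<forall>c \<in> C. pre_digraph.cycle G c) \<and>
     pairwise (\<lambda>c d. cycle_verts G c \<inter> cycle_verts G d = {}) C"

definition path_cycle_family ::
  "('a, 'b) pre_digraph \<Rightarrow> ('a \<times> 'b list) set \<Rightarrow> 'b list set \<Rightarrow> bool" where
  "path_cycle_family G P C \<longleftrightarrow> path_family G P \<and> cycle_family G C \<and>
     (\<Union>p \<in> P. path_verts G p) \<inter> (\<Union>c \<in> C. cycle_verts G c) = {}"

definition family_size :: "('a \<times> 'b list) set \<Rightarrow> 'b list set \<Rightarrow> nat" where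
  "family_size P C = card ((\<Union>(u, p) \<in> P. set p) \<union> (\<Union>c \<in> C. set c))"

definition max_family_size :: "('a, 'b) pre_digraph \<Rightarrow> nat" where
  "max_family_size G = Max {family_size P C | P C. path_cycle_family G P C}"

text \<open>Again the maximum is over a finite nonempty set.\<close>

lemma finite_family_sizes:
  assumes "finite (arcs G)"
  shows "finite {family_size P C | P C. path_cycle_family G P C}"
proof (rule finite_subset)
  show "{family_size P C | P C. path_cycle_family G P C} \<subseteq> {..card (arcs G)}"
  proof safe
    fix P C assume "path_cycle_family G P C"
    then have "(\<Union>(u, p) \<in> P. set p) \<union> (\<Union>c \<in> C. set c) \<subseteq> arcs G"
      by (fastforce simp: path_cycle_family_def path_family_def cycle_family_def
          pre_digraph.apath_def pre_digraph.cycle_def pre_digraph.awalk_def)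
    then show "family_size P C \<le> card (arcs G)"
      unfolding family_size_def using assms by (rule card_mono[rotated])
  qed
qed simp

lemma path_cycle_family_empty: "path_cycle_family G {} {}"
  by (simp add: path_cycle_family_def path_family_def cycle_family_def)

lemma finite_arcs_sys_graph: "finite (arcs (sys_graph A b))"
  by (rule finite_subset[of _ "{..dim_row A} \<times> {..dim_row A}"]) (auto simp: sys_graph_def)

end

theory Submission
  imports Defs
begin

text \<open>
  Both sides of the equivalence are statements about maximum matchings of one relation \<open>R\<close>,
  the set of pairs (column, row) of nonzero entries of \<open>[A, b]\<close>. These pairs are exactly the
  arcs of the system digraph, and deleting the arcs out of \<open>j\<close> or into \<open>i\<close> deletes column \<open>j\<close>
  or row \<open>i\<close>.

  On the graph side, a set of arcs is the arc set of a path-cycle family iff no two of its arcs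
  share a tail or a head, because a digraph with in- and out-degrees at most 1 is a disjoint union
  of paths and cycles (\<open>path_cycle_family_arcs\<close>, \<open>ex_path_cycle_family\<close>). So the maximum size of
  a family is the maximum size of a matching of arcs.

  On the matrix side, the generic rank of a structured matrix is the maximum size of a matching of
  its nonzero entries (\<open>grank_eq_max_matching\<close>). Independent columns of a realization extend to
  an invertible matrix, whose determinant has a nonzero term in its Leibniz expansion; conversely
  the 0-1 matrix of a matching has distinct unit vectors among its columns.

  Controllability forces \<open>[A, b]\<close> to have rank \<open>n\<close> (\<open>controllable_full_rank\<close>). So \<open>R\<close> has a matching of size \<open>n\<close>, and without column \<open>j\<close>
  still one of size \<open>n - 1\<close>, that is, \<open>r\<^sub>j \<ge> n - 1\<close>. A set of rows that avoids \<open>i\<close> and has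
  \<open>r\<^sub>j\<close> elements can then only consist of all the other \<open>n - 1\<close> rows. Hence \<open>i\<close> lies outside some
  generic row basis iff \<open>r\<^sub>j = n - 1\<close> and deleting row \<open>i\<close> preserves this generic rank, which are
  the two conditions on the digraph.
\<close>

section \<open>Arc sets of path-cycle families\<close>

text \<open>
  Equal values of \<open>f\<close> force both arguments into the same block, since the values of \<open>f\<close> on distinct
  blocks lie in disjoint sets. Applied to the tail and head maps, with the vertex sets of the
  members of a family as the disjoint sets.
\<close>

lemma inj_on_UN_separated:
  assumes "\<And>X. X \<in> K \<Longrightarrow> inj_on f (S X)"
    and "\<And>X. X \<in> K \<Longrightarrow> f ` S X \<subseteq> V X"
    and "pairwise (\<lambda>X Y. V X \<inter> V Y = {}) K"
  shows "inj_on f (\<Union>X\<in>K. S X)"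
proof (rule inj_onI)
  fix x y
  assume x: "x \<in> (\<Union>X\<in>K. S X)" and y: "y \<in> (\<Union>X\<in>K. S X)" and eq: "f x = f y"
  obtain X Y where X: "X \<in> K" "x \<in> S X" and Y: "Y \<in> K" "y \<in> S Y"
    using x y by auto
  have "f x \<in> V X \<inter> V Y"
    using assms(2) X Y eq by fastforce
  then have "X = Y"
    using assms(3) X(1) Y(1) unfolding pairwise_def by blast
  then show "x = y"
    using assms(1) X Y eq by (auto dest: inj_onD)
qed

definition family_arcs :: "('a \<times> 'b list) set \<Rightarrow> 'b list set \<Rightarrow> 'b set" where
  "family_arcs P C = (\<Union>(u, p) \<in> P. set p) \<union> (\<Union>c \<in> C. set c)"

context wf_digraph
begin

lemma apath_degree_le_1:
  assumes "apath u p v"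
  shows "inj_on (tail G) (set p)" and "inj_on (head G) (set p)"
    and "tail G ` set p \<subseteq> path_verts G (u, p)" and "head G ` set p \<subseteq> path_verts G (u, p)"
proof -
  have c: "cas u p v" and d: "distinct (awalk_verts u p)"
    using assms by (auto simp: apath_def awalk_def)
  show "inj_on (tail G) (set p)"
    using d by (auto simp: awalk_verts_conv distinct_map split: if_splits)
  show "inj_on (head G) (set p)"
    using d by (auto simp: awalk_verts_conv'[OF c] distinct_map split: if_splits)
  show "tail G ` set p \<subseteq> path_verts G (u, p)" "head G ` set p \<subseteq> path_verts G (u, p)"
    using set_awalk_verts_cas[OF c] by (auto simp: path_verts_def)
qed

text \<open>
  A cycle is only required to have distinct vertices after its first one, which makes the heads
  distinct. The tails are the same vertices in rotated order, so they are distinct as well.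
\<close>

lemma cycle_degree_le_1:
  assumes "cycle c"
  shows "inj_on (tail G) (set c)" and "inj_on (head G) (set c)"
    and "cycle_verts G c = tail G ` set c" and "cycle_verts G c = head G ` set c"
proof -
  obtain u where w: "awalk u c u" and d: "distinct (tl (awalk_verts u c))" and ne: "c \<noteq> []"
    using assms by (auto simp: cycle_def)
  have cas: "cas u c u"
    using w by (simp add: awalk_def)
  have tl: "tl (awalk_verts u c) = map (head G) c"
    using ne by (simp add: awalk_verts_conv'[OF cas])
  have hd: "tail G (hd c) = u"
    using cas ne by (cases c) auto
  have last: "head G (last c) = u"
    using awlast_if_cas[OF cas] ne by (simp add: awalk_verts_conv)
  \<comment> \<open>the last head of a closed walk is its first tail, so tails and heads list the same vertices\<close>
  have same: "set (map (tail G) c) = set (map (head G) c)"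
  proof -
    have ins: "insert u (set (map (tail G) c)) = insert u (set (map (head G) c))"
      using arg_cong[OF awalk_verts_conv[of u c], of set]
        arg_cong[OF awalk_verts_conv'[OF cas], of set] ne hd last by simp
    have "u \<in> set (map (tail G) c)" "u \<in> set (map (head G) c)"
      using hd last ne by (metis hd_in_set image_eqI set_map, metis last_in_set image_eqI set_map)
    with ins show ?thesis by (simp add: insert_absorb)
  qed
  show "inj_on (head G) (set c)"
    using d by (simp add: tl distinct_map)
  have dh: "distinct (map (head G) c)"
    using d by (simp add: tl)
  then have "distinct (map (tail G) c)"
    using same by (metis card_distinct distinct_card length_map)
  then show "inj_on (tail G) (set c)"
    by (simp add: distinct_map)
  have "cycle_verts G c = set (map (tail G) c) \<union> set (map (head G) c)"
    unfolding cycle_verts_def hd by (rule set_awalk_verts_not_Nil_cas[OF cas ne])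
  then show "cycle_verts G c = tail G ` set c" "cycle_verts G c = head G ` set c"
    using same by auto
qed

lemma path_cycle_family_arcs:
  assumes "path_cycle_family G P C"
  shows "family_arcs P C \<subseteq> arcs G"
    and "inj_on (tail G) (family_arcs P C)" and "inj_on (head G) (family_arcs P C)"
proof -
  have P: "\<And>X. X \<in> P \<Longrightarrow> \<exists>v. apath (fst X) (snd X) v"
    and C: "\<And>c. c \<in> C \<Longrightarrow> cycle c"
    and disjP: "pairwise (\<lambda>p q. path_verts G p \<inter> path_verts G q = {}) P"
    and disjC: "pairwise (\<lambda>c d. cycle_verts G c \<inter> cycle_verts G d = {}) C"
    and disj: "(\<Union>p \<in> P. path_verts G p) \<inter> (\<Union>c \<in> C. cycle_verts G c) = {}"
    using assms by (auto simp: path_cycle_family_def path_family_def cycle_family_def)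
  have arcsP: "set (snd X) \<subseteq> arcs G" if "X \<in> P" for X
    using P[OF that] by (auto simp: apath_def awalk_def)
  have arcsC: "set c \<subseteq> arcs G" if "c \<in> C" for c
    using C[OF that] by (auto simp: cycle_def awalk_def)
  have fa: "family_arcs P C = (\<Union>X\<in>P. set (snd X)) \<union> (\<Union>c\<in>C. set c)"
    by (simp add: family_arcs_def case_prod_beta)
  show "family_arcs P C \<subseteq> arcs G"
    unfolding fa using arcsP arcsC by blast
  have inj: "inj_on f (family_arcs P C)"
    if fP: "\<And>X. X \<in> P \<Longrightarrow> inj_on f (set (snd X)) \<and> f ` set (snd X) \<subseteq> path_verts G X"
      and fC: "\<And>c. c \<in> C \<Longrightarrow> inj_on f (set c) \<and> f ` set c \<subseteq> cycle_verts G c" for f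
  proof -
    have "inj_on f (\<Union>X\<in>P. set (snd X))"
      using fP disjP by (intro inj_on_UN_separated[where V = "path_verts G"]) auto
    moreover have "inj_on f (\<Union>c\<in>C. set c)"
      using fC disjC by (intro inj_on_UN_separated[where V = "cycle_verts G"]) auto
    moreover have "f ` (\<Union>X\<in>P. set (snd X)) \<subseteq> (\<Union>p \<in> P. path_verts G p)"
      using fP by fastforce
    moreover have "f ` (\<Union>c\<in>C. set c) \<subseteq> (\<Union>c \<in> C. cycle_verts G c)"
      using fC by fastforce
    ultimately show ?thesis
      unfolding fa inj_on_Un using disj by blast
  qed
  show "inj_on (tail G) (family_arcs P C)"
    using P C apath_degree_le_1 cycle_degree_le_1 by (intro inj) (metis prod.collapse, auto)
  show "inj_on (head G) (family_arcs P C)"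
    using P C apath_degree_le_1 cycle_degree_le_1 by (intro inj) (metis prod.collapse, auto)
qed

lemma apath_verts_Cons:
  assumes "apath s p t"
  shows "awalk_verts s p = s # map (head G) p"
    and "set (awalk_verts s p) = insert t (tail G ` set p)"
proof -
  have c: "cas s p t"
    using assms by (auto simp: apath_def awalk_def)
  show "awalk_verts s p = s # map (head G) p"
    unfolding awalk_verts_conv'[OF c] using c by (cases p) auto
  show "set (awalk_verts s p) = insert t (tail G ` set p)"
    using awlast_if_cas[OF c] by (auto simp: awalk_verts_conv)
qed

text \<open>
  The family is built by adding one arc at a time. The covering condition strengthens the induction:
  vertices on no arc are kept as paths of length 0, so that both ends of the new arc always lie on
  members of the family. By the injectivity assumptions its tail must be the last vertex of a path
  and its head the first vertex of a path. If the two paths are the same, the arc closes it to a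
  cycle; otherwise it joins them into one path.
\<close>

lemma ex_path_cycle_family:
  assumes "finite E" "E \<subseteq> arcs G" "inj_on (tail G) E" "inj_on (head G) E"
  shows "\<exists>P C. path_cycle_family G P C \<and> family_arcs P C = E \<and>
    verts G \<subseteq> (\<Union>p \<in> P. path_verts G p) \<union> (\<Union>c \<in> C. cycle_verts G c)"
  using assms
proof (induction E rule: finite_induct)
  case empty
  have "path_cycle_family G ((\<lambda>u. (u, [])) ` verts G) {}"
    by (auto simp: path_cycle_family_def path_family_def cycle_family_def apath_Nil_iff
        path_verts_def pairwise_def)
  moreover have "family_arcs ((\<lambda>u. (u, [])) ` verts G) {} = {}"
    by (auto simp: family_arcs_def)
  moreover have "verts G \<subseteq> (\<Union>p \<in> (\<lambda>u. (u, [])) ` verts G. path_verts G p)"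
    by (auto simp: path_verts_def)
  ultimately show ?case by blast
next
  case (insert e E)
  obtain P C where fam: "path_cycle_family G P C" and E: "family_arcs P C = E"
    and cover: "verts G \<subseteq> (\<Union>p \<in> P. path_verts G p) \<union> (\<Union>c \<in> C. cycle_verts G c)"
    using insert by (auto simp: inj_on_insert)
  have P: "\<And>s p. (s, p) \<in> P \<Longrightarrow> \<exists>v. apath s p v"
    and C: "\<And>c. c \<in> C \<Longrightarrow> cycle c"
    and disjP: "pairwise (\<lambda>p q. path_verts G p \<inter> path_verts G q = {}) P"
    and disjC: "pairwise (\<lambda>c d. cycle_verts G c \<inter> cycle_verts G d = {}) C"
    and disj: "(\<Union>p \<in> P. path_verts G p) \<inter> (\<Union>c \<in> C. cycle_verts G c) = {}"
    using fam by (auto simp: path_cycle_family_def path_family_def cycle_family_def)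
  have e: "e \<in> arcs G" "tail G e \<in> verts G" "head G e \<in> verts G"
    using insert.prems by auto
  have tail_new: "tail G e \<notin> tail G ` E" and head_new: "head G e \<notin> head G ` E"
    using insert.prems insert.hyps(2) by (auto simp: inj_on_insert)
  have EP: "set p \<subseteq> E" if "(s, p) \<in> P" for s p
    using that E by (fastforce simp: family_arcs_def)
  have EC: "set c \<subseteq> E" if "c \<in> C" for c
    using that E by (fastforce simp: family_arcs_def)
  \<comment> \<open>no arc of \<open>E\<close> leaves the tail of the new arc, so this vertex can only end a path\<close>
  have "\<not> (\<exists>c\<in>C. tail G e \<in> cycle_verts G c)"
    using cycle_degree_le_1(3)[OF C] EC tail_new by blast
  then obtain s p where sp: "(s, p) \<in> P" "tail G e \<in> path_verts G (s, p)"
    using cover e by fastforce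
  obtain t where t: "apath s p t" using P sp by blast
  have p: "apath s p (tail G e)"
    using apath_verts_Cons(2)[OF t] t sp tail_new EP[OF sp(1)] by (auto simp: path_verts_def)
  \<comment> \<open>likewise the head of the new arc can only begin a path\<close>
  have "\<not> (\<exists>c\<in>C. head G e \<in> cycle_verts G c)"
    using cycle_degree_le_1(4)[OF C] EC head_new by blast
  then obtain s' q where sq: "(s', q) \<in> P" "head G e \<in> path_verts G (s', q)"
    using cover e by fastforce
  obtain t' where t': "apath s' q t'" using P sq by blast
  have s': "s' = head G e"
    using apath_verts_Cons(1)[OF t'] sq head_new EP[OF sq(1)] by (auto simp: path_verts_def)
  have wp: "awalk s p (tail G e)" and wq: "awalk (head G e) q t'"
    using p t' s' by (auto simp: apath_def)
  show ?case
  proof (cases "(s, p) = (s', q)")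
    case True
    let ?c = "p @ [e]"
    let ?P = "P - {(s, p)}"
    let ?C = "insert ?c C"
    have s: "s = head G e" using True s' by simp
    have w: "awalk s ?c s"
      using wp e s by (auto simp: awalk_simps)
    have "cas s ?c s"
      using w by (simp add: awalk_def)
    then have "tl (awalk_verts s ?c) = map (head G) p @ [s]"
      using s by (simp add: awalk_verts_conv' del: cas_append_iff)
    then have "distinct (tl (awalk_verts s ?c))"
      using p by (simp add: apath_def apath_verts_Cons(1)[OF p])
    then have cyc: "cycle ?c"
      using w unfolding cycle_def by blast
    have v: "cycle_verts G ?c = path_verts G (s, p)"
      using cycle_degree_le_1(4)[OF cyc] s
      by (auto simp: path_verts_def apath_verts_Cons(1)[OF p[unfolded s]])
    have fresh: "path_verts G (s, p) \<inter> path_verts G x = {}" if "x \<in> ?P" for x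
      using disjP sp that by (auto simp: pairwise_def)
    have freshC: "path_verts G (s, p) \<inter> cycle_verts G c = {}" if "c \<in> C" for c
      using disj sp that by blast
    have "path_family G ?P"
      using P pairwise_subset[OF disjP] by (auto simp: path_family_def)
    moreover have "cycle_family G ?C"
      using C cyc disjC freshC v by (auto simp: cycle_family_def pairwise_insert)
    moreover have "(\<Union>p \<in> ?P. path_verts G p) \<inter> (\<Union>c \<in> ?C. cycle_verts G c) = {}"
      using fresh disj v by blast
    ultimately have "path_cycle_family G ?P ?C"
      by (simp add: path_cycle_family_def)
    moreover have "family_arcs ?P ?C = insert e E"
      unfolding E[symmetric] family_arcs_def using sp by auto
    moreover have "verts G \<subseteq> (\<Union>p \<in> ?P. path_verts G p) \<union> (\<Union>c \<in> ?C. cycle_verts G c)"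
    proof -
      have "(\<Union>p \<in> P. path_verts G p) = cycle_verts G ?c \<union> (\<Union>p \<in> ?P. path_verts G p)"
        unfolding v using sp by blast
      then show ?thesis using cover by auto
    qed
    ultimately show ?thesis by blast
  next
    case False
    let ?r = "(s, p @ e # q)"
    let ?Q = "P - {(s, p), (s', q)}"
    let ?P = "insert ?r ?Q"
    have pq: "path_verts G (s, p) \<inter> path_verts G (s', q) = {}"
      using disjP sp sq False by (auto simp: pairwise_def)
    have w: "awalk s (p @ e # q) t'"
      using wp wq e by (auto simp: awalk_simps)
    have verts: "awalk_verts s (p @ e # q) = awalk_verts s p @ awalk_verts s' q"
      using awalk_verts_append[OF w] s' by simp
    have r: "apath s (p @ e # q) t'"
      using w p t' pq by (auto simp: apath_def verts path_verts_def)
    have v: "path_verts G ?r = path_verts G (s, p) \<union> path_verts G (s', q)"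
      by (simp add: path_verts_def verts)
    have fresh: "path_verts G ?r \<inter> path_verts G x = {}" if "x \<in> ?Q" for x
      using disjP sp sq that v by (auto simp: pairwise_def)
    have freshC: "path_verts G ?r \<inter> cycle_verts G c = {}" if "c \<in> C" for c
      using disj sp sq that v by blast
    have "path_family G ?P"
      unfolding path_family_def
    proof
      show "\<forall>(u, p)\<in>?P. \<exists>v. apath u p v"
        using P r by blast
      have "pairwise (\<lambda>p q. path_verts G p \<inter> path_verts G q = {}) ?Q"
        using disjP by (rule pairwise_subset) blast
      then show "pairwise (\<lambda>p q. path_verts G p \<inter> path_verts G q = {}) ?P"
        using fresh unfolding pairwise_insert by blast
    qed
    moreover have "(\<Union>p \<in> ?P. path_verts G p) \<inter> (\<Union>c \<in> C. cycle_verts G c) = {}"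
      using freshC disj by blast
    ultimately have "path_cycle_family G ?P C"
      using fam by (simp add: path_cycle_family_def)
    moreover have "family_arcs ?P C = insert e E"
    proof -
      have "family_arcs P C = set p \<union> set q \<union> family_arcs ?Q C"
        unfolding family_arcs_def using sp sq by auto
      then show ?thesis
        unfolding E[symmetric] by (auto simp: family_arcs_def)
    qed
    moreover have "verts G \<subseteq> (\<Union>p \<in> ?P. path_verts G p) \<union> (\<Union>c \<in> C. cycle_verts G c)"
    proof -
      have "(\<Union>p \<in> P. path_verts G p) = (\<Union>p \<in> ?P. path_verts G p)"
        unfolding UN_insert v using sp sq by blast
      then show ?thesis using cover by simp
    qed
    ultimately show ?thesis by blast
  qed
qed

lemma max_family_size_eq:
  assumes "finite (arcs G)"
  shows "max_family_size G =
    Max (card ` {E. E \<subseteq> arcs G \<and> inj_on (tail G) E \<and> inj_on (head G) E})"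
proof -
  have "{family_size P C | P C. path_cycle_family G P C} =
      card ` {E. E \<subseteq> arcs G \<and> inj_on (tail G) E \<and> inj_on (head G) E}" (is "?L = card ` ?M")
  proof
    show "?L \<subseteq> card ` ?M"
      using path_cycle_family_arcs by (fastforce simp: family_size_def family_arcs_def)
    show "card ` ?M \<subseteq> ?L"
    proof
      fix m assume "m \<in> card ` ?M"
      then obtain E where "E \<in> ?M" "m = card E" by blast
      moreover from this obtain P C where "path_cycle_family G P C" "family_arcs P C = E"
        using ex_path_cycle_family[of E] finite_subset[OF _ assms] by auto
      ultimately show "m \<in> ?L"
        by (auto simp: family_size_def family_arcs_def)
    qed
  qed
  then show ?thesis by (simp add: max_family_size_def)
qed

end

section \<open>Maximum matchings of a relation\<close>

definition matching :: "('a \<times> 'b) set \<Rightarrow> bool" where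
  "matching E \<longleftrightarrow> inj_on fst E \<and> inj_on snd E"

definition max_matching :: "('a \<times> 'b) set \<Rightarrow> nat" where
  "max_matching R = Max (card ` {E. E \<subseteq> R \<and> matching E})"

lemma max_matching_ge:
  assumes "finite R" "E \<subseteq> R" "matching E"
  shows "card E \<le> max_matching R"
  unfolding max_matching_def using assms by (intro Max_ge) auto

lemma max_matching_attained:
  assumes "finite R"
  obtains E where "E \<subseteq> R" "matching E" "card E = max_matching R"
proof -
  have "{} \<in> {E. E \<subseteq> R \<and> matching E}"
    by (simp add: matching_def)
  then have "max_matching R \<in> card ` {E. E \<subseteq> R \<and> matching E}"
    unfolding max_matching_def using assms by (intro Max_in) auto
  then show thesis using that by auto
qed

text \<open>
  Matchings are insensitive to a renaming of either side; this is what allows passing to a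
  submatrix, whose rows and columns are renumbered.
\<close>

lemma max_matching_map_prod:
  assumes "inj_on f (fst ` R)" "inj_on g (snd ` R)"
  shows "max_matching (map_prod f g ` R) = max_matching R"
proof -
  let ?h = "map_prod f g"
  have h: "inj_on ?h R"
    using assms by (auto simp: inj_on_def)
  have match: "matching (?h ` E) \<longleftrightarrow> matching E" if "E \<subseteq> R" for E
  proof -
    have hE: "inj_on ?h E" using h that by (rule inj_on_subset)
    have fE: "inj_on f (fst ` E)" and gE: "inj_on g (snd ` E)"
      using assms that by (meson image_mono inj_on_subset)+
    have "inj_on fst (?h ` E) \<longleftrightarrow> inj_on (f \<circ> fst) E"
      using comp_inj_on_iff[OF hE, of fst] by (simp add: fst_comp_map_prod)
    moreover have "inj_on snd (?h ` E) \<longleftrightarrow> inj_on (g \<circ> snd) E"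
      using comp_inj_on_iff[OF hE, of snd] by (simp add: snd_comp_map_prod)
    moreover have "inj_on (f \<circ> fst) E \<longleftrightarrow> inj_on fst E"
      using comp_inj_on fE inj_on_imageI2 by blast
    moreover have "inj_on (g \<circ> snd) E \<longleftrightarrow> inj_on snd E"
      using comp_inj_on gE inj_on_imageI2 by blast
    ultimately show ?thesis by (simp add: matching_def)
  qed
  have "{E. E \<subseteq> ?h ` R \<and> matching E} = image ?h ` {E. E \<subseteq> R \<and> matching E}"
    using match by (auto simp: subset_image_iff)
  then have "card ` {E. E \<subseteq> ?h ` R \<and> matching E} = (\<lambda>E. card (?h ` E)) ` {E. E \<subseteq> R \<and> matching E}"
    by (simp add: image_image)
  also have "\<dots> = card ` {E. E \<subseteq> R \<and> matching E}"
    using h by (intro image_cong refl card_image) (auto intro: inj_on_subset)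
  finally show ?thesis by (simp add: max_matching_def)
qed

text \<open>
  At most one pair of a matching has first component \<open>x\<close>.
\<close>

lemma max_matching_remove_fst:
  assumes "finite R"
  shows "max_matching R - 1 \<le> max_matching {e \<in> R. fst e \<noteq> x}"
proof -
  obtain E where E: "E \<subseteq> R" "matching E" "card E = max_matching R"
    using max_matching_attained[OF assms] by blast
  have fin: "finite E" using E(1) assms by (rule finite_subset)
  let ?D = "{e \<in> E. fst e = x}"
  have "card ?D \<le> 1"
    using E(2) fin card_le_Suc0_iff_eq[of ?D] by (fastforce simp: matching_def inj_on_def)
  then have "card E - 1 \<le> card (E - ?D)"
    using diff_card_le_card_Diff[of ?D E] fin by simp
  also have "\<dots> \<le> max_matching {e \<in> R. fst e \<noteq> x}"
    using E assms by (intro max_matching_ge) (auto simp: matching_def intro: inj_on_subset)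
  finally show ?thesis using E by simp
qed

section \<open>Generic rank as a maximum matching\<close>

text \<open>
  The column comes first, so that the entries of \<open>[A, b]\<close> become the arcs of its system digraph.
\<close>

definition entry_arcs :: "entry mat \<Rightarrow> (nat \<times> nat) set" where
  "entry_arcs S = {(l, k). k < dim_row S \<and> l < dim_col S \<and> S $$ (k, l) \<noteq> Zero}"

lemma finite_entry_arcs: "finite (entry_arcs S)"
  by (rule finite_subset[of _ "{..<dim_col S} \<times> {..<dim_row S}"]) (auto simp: entry_arcs_def)

lemma (in vec_space) lin_indpt_extend_basis:
  assumes "S \<subseteq> carrier_vec n" "lin_indpt S"
  obtains T where "finite T" "S \<inter> T = {}" "S \<union> T \<subseteq> carrier_vec n"
    "lin_indpt (S \<union> T)" "card (S \<union> T) = n"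
proof -
  have finS: "finite S"
    using fin_dim_li_fin[OF fin_dim assms(2)] assms(1) by simp
  have span: "span (set (unit_vecs n)) = carrier_vec n"
    by (rule span_unit_vecs_is_carrier)
  have units: "set (unit_vecs n) \<subseteq> carrier_vec n"
    by (auto simp: unit_vecs_def)
  have "\<exists>T. finite T \<and> T \<subseteq> carrier_vec n \<and> T \<subseteq> span (set (unit_vecs n)) \<and> T \<inter> S = {} \<and>
      int (card T) \<le> int (card (set (unit_vecs n :: 'a vec list))) - int (card S) \<and>
      span (S \<union> T) = span (set (unit_vecs n))"
    by (rule replacement[OF finS _ _ assms(2)]) (use span units assms(1) in auto)
  then obtain T where T: "finite T" "T \<subseteq> carrier_vec n" "T \<inter> S = {}"
      "int (card T) \<le> int n - int (card S)" "span (S \<union> T) = carrier_vec n"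
    using span by (auto simp: distinct_card[OF unit_vecs_distinct])
  have sub: "S \<union> T \<subseteq> carrier_vec n" using assms T by simp
  have card: "card (S \<union> T) \<le> n"
    using T finS by (simp add: card_Un_disjoint Int_commute)
  have basis: "basis (S \<union> T)"
    using T finS sub card dim_is_n by (intro dim_gen_is_basis) auto
  then have card_eq: "card (S \<union> T) = n"
    using dim_basis[of "S \<union> T"] T finS dim_is_n by simp
  have "S \<inter> T = {}" using T by (simp add: Int_commute)
  moreover have "lin_indpt (S \<union> T)" using basis by (simp add: basis_def)
  ultimately show thesis using that[OF T(1) _ sub _ card_eq] by simp
qed

lemma det_nonzero_transversal:
  fixes M :: "'a :: comm_ring_1 mat"
  assumes "M \<in> carrier_mat n n" "det M \<noteq> 0"
  obtains p where "p permutes {0..<n}" "\<And>k. k < n \<Longrightarrow> M $$ (k, p k) \<noteq> 0"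
proof -
  have "(\<Sum>p | p permutes {0..<n}. signof p * (\<Prod>k = 0..<n. M $$ (k, p k))) \<noteq> 0"
    using assms(2) unfolding det_def'[OF assms(1)] .
  then obtain p where p: "p permutes {0..<n}" "signof p * (\<Prod>k = 0..<n. M $$ (k, p k)) \<noteq> 0"
    by (rule sum.not_neutral_contains_not_neutral) simp
  have "M $$ (k, p k) \<noteq> 0" if "k < n" for k
  proof
    assume "M $$ (k, p k) = 0"
    then have "(\<Prod>k = 0..<n. M $$ (k, p k)) = 0"
      using that by (subst prod.remove[of _ k]) auto
    with p show False by simp
  qed
  with p show thesis using that by blast
qed

text \<open>
  Completing a maximal independent set of columns to a basis avoids any comparison of row rank with
  column rank: the basis vectors form an invertible \<open>n \<times> n\<close> matrix, and a nonzero Leibniz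
  term of its determinant assigns distinct rows to all basis vectors, in particular to the columns
  of \<open>M\<close> among them.
\<close>

lemma matching_of_rank:
  fixes M :: "'a :: field mat"
  assumes M: "M \<in> carrier_mat n nc"
  shows "\<exists>E \<subseteq> {(l, k). k < n \<and> l < nc \<and> M $$ (k, l) \<noteq> 0}.
    matching E \<and> card E = vec_space.rank n M"
proof -
  interpret vec_space "TYPE('a)" n .
  have cols: "set (cols M) \<subseteq> carrier_vec n"
    using M cols_dim[of M] by simp
  obtain S where S: "maximal S (\<lambda>T. T \<subseteq> set (cols M) \<and> lin_indpt T)"
    using maximal_exists_superset[of "set (cols M)" "\<lambda>T. T \<subseteq> set (cols M) \<and> lin_indpt T" "{}"]
    by (auto simp: finite_lin_indpt2)
  then have sub: "S \<subseteq> set (cols M)" and li: "lin_indpt S"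
    by (auto simp: maximal_def)
  have rank: "rank M = card S"
    using M S by (rule rank_card_indpt)
  obtain T where T: "finite T" "S \<inter> T = {}" "S \<union> T \<subseteq> carrier_vec n"
    "lin_indpt (S \<union> T)" "card (S \<union> T) = n"
    using lin_indpt_extend_basis[OF _ li] sub cols by blast
  have finS: "finite S" using sub finite_subset by blast
  obtain xs where xs: "set xs = S" "distinct xs" using finite_distinct_list[OF finS] by blast
  obtain ys where ys: "set ys = T" "distinct ys" using finite_distinct_list[OF T(1)] by blast
  \<comment> \<open>the columns taken from \<open>M\<close> come first\<close>
  let ?N = "mat_of_cols n (xs @ ys)"
  have dist: "distinct (xs @ ys)" using xs ys T by simp
  then have len: "length (xs @ ys) = n"
    using T(5) xs ys by (metis distinct_card set_append)
  have N: "?N \<in> carrier_mat n n" using len mat_of_cols_carrier(1)[of n "xs @ ys"] by simp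
  have colsN: "cols ?N = xs @ ys"
    using T xs ys by (intro cols_mat_of_cols) auto
  have "rank ?N = n"
    using N dist T xs ys colsN by (intro lin_indpt_full_rank) auto
  then have "det ?N \<noteq> 0" using det_rank_iff[OF N] by simp
  then obtain p where p: "p permutes {0..<n}" "\<And>k. k < n \<Longrightarrow> ?N $$ (k, p k) \<noteq> 0"
    using det_nonzero_transversal[OF N] by blast
  have "\<forall>v\<in>S. \<exists>l<nc. col M l = v"
    using sub M by (fastforce simp: cols_def)
  then obtain g where g: "\<And>v. v \<in> S \<Longrightarrow> g v < nc \<and> col M (g v) = v"
    by metis
  let ?r = "length xs"
  let ?row = "inv_into UNIV p"
  let ?f = "\<lambda>c. (g (xs ! c), ?row c)"
  have r: "?r = card S" "?r \<le> n" using distinct_card[OF xs(2)] xs(1) len by auto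
  have row: "?row c < n" "p (?row c) = c" if "c < ?r" for c
  proof -
    show "p (?row c) = c" using p(1) by (simp add: permutes_inverses)
    have "?row c \<in> {0..<n}" using permutes_in_image[OF permutes_inv[OF p(1)], of c] that r by simp
    then show "?row c < n" by simp
  qed
  have nz: "M $$ (?row c, g (xs ! c)) \<noteq> 0" if c: "c < ?r" for c
  proof -
    have "?N $$ (?row c, c) \<noteq> 0" using p(2)[OF row(1)[OF c]] row(2)[OF c] by simp
    then have "xs ! c $ ?row c \<noteq> 0"
      using row[OF c] c len by (simp add: mat_of_cols_index nth_append)
    moreover have "xs ! c \<in> S" using c xs by auto
    then have "col M (g (xs ! c)) $ ?row c = xs ! c $ ?row c" and "g (xs ! c) < nc"
      using g by simp_all
    ultimately show ?thesis using row[OF c] M by simp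
  qed
  have inj_fst: "inj_on (\<lambda>c. g (xs ! c)) {..<?r}"
  proof (rule inj_onI)
    fix c d assume c: "c \<in> {..<?r}" and d: "d \<in> {..<?r}" and eq: "g (xs ! c) = g (xs ! d)"
    have "xs ! c \<in> S" "xs ! d \<in> S" using c d xs by auto
    then have "xs ! c = xs ! d" using g eq by metis
    then show "c = d" using c d xs nth_eq_iff_index_eq by auto
  qed
  have inj_snd: "inj_on ?row {..<?r}"
    using permutes_inj[OF permutes_inv[OF p(1)]] by (rule inj_on_subset) simp
  have injf: "inj_on ?f {..<?r}" using inj_fst by (auto simp: inj_on_def)
  have "matching (?f ` {..<?r})"
    unfolding matching_def
    using inj_fst inj_snd comp_inj_on_iff[OF injf, of fst] comp_inj_on_iff[OF injf, of snd]
    by (simp add: comp_def)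
  moreover have "card (?f ` {..<?r}) = rank M"
    using injf r rank by (simp add: card_image)
  moreover have "?f ` {..<?r} \<subseteq> {(l, k). k < n \<and> l < nc \<and> M $$ (k, l) \<noteq> 0}"
    using nz row g xs by auto
  ultimately show ?thesis by blast
qed

text \<open>
  In the 0-1 matrix of a matching, the columns that take part are distinct unit vectors.
\<close>

lemma rank_matching_ge:
  assumes "matching E" "E \<subseteq> {..<nc} \<times> {..<n}"
  shows "card E \<le> vec_space.rank n (mat n nc (\<lambda>(k, l). if (l, k) \<in> E then 1 else 0 :: 'a :: field))"
    (is "_ \<le> vec_space.rank n ?M")
proof -
  interpret vec_space "TYPE('a)" n .
  let ?U = "unit_vec n ` snd ` E :: 'a vec set"
  have "col ?M l = unit_vec n k" if lk: "(l, k) \<in> E" for l k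
  proof (rule eq_vecI)
    have bounds: "l < nc" "k < n" using lk assms(2) by auto
    have "(l, k') \<in> E \<longleftrightarrow> k' = k" for k'
      using lk assms(1) by (fastforce simp: matching_def inj_on_def)
    then show "col ?M l $ k' = unit_vec n k $ k'" if "k' < dim_vec (unit_vec n k)" for k'
      using that bounds by simp
  qed simp
  then have col: "col ?M (fst e) = unit_vec n (snd e)" if "e \<in> E" for e
    using that by (cases e) simp
  have "?U \<subseteq> set (cols ?M)"
  proof
    fix v assume "v \<in> ?U"
    then obtain e where e: "e \<in> E" "v = unit_vec n (snd e)" by blast
    then have "v = col ?M (fst e)" "fst e \<in> {0..<nc}"
      using col assms(2) by auto
    then show "v \<in> set (cols ?M)"
      unfolding cols_def set_map set_upt dim_col_mat by (rule image_eqI)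
  qed
  moreover have "lin_indpt ?U"
  proof -
    have "?U \<subseteq> set (unit_vecs n)" using assms(2) by (auto simp: unit_vecs_def)
    then show ?thesis using unit_vecs_basis subset_li_is_li unfolding basis_def by blast
  qed
  ultimately have "card ?U \<le> rank ?M"
    by (intro rank_ge_card_indpt[where nc = nc]) auto
  moreover have "card ?U = card E"
  proof -
    have "inj_on (unit_vec n :: nat \<Rightarrow> 'a vec) (snd ` E)"
      using assms(2) by (auto simp: inj_on_def)
    then show ?thesis using assms(1) by (simp add: card_image matching_def)
  qed
  ultimately show ?thesis by simp
qed

lemma mat_rank_le_max_matching:
  assumes "M \<in> realizations S"
  shows "mat_rank M \<le> max_matching (entry_arcs S)"
proof -
  have M: "M \<in> carrier_mat (dim_row S) (dim_col S)"
    using assms by (simp add: realizations_def)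
  obtain E where E: "E \<subseteq> {(l, k). k < dim_row S \<and> l < dim_col S \<and> M $$ (k, l) \<noteq> 0}"
    "matching E" "card E = vec_space.rank (dim_row S) M"
    using matching_of_rank[OF M] by blast
  have "E \<subseteq> entry_arcs S"
    using E(1) assms by (auto simp: entry_arcs_def realizations_def)
  then have "card E \<le> max_matching (entry_arcs S)"
    using E(2) by (intro max_matching_ge finite_entry_arcs)
  then show ?thesis using E(3) M by (simp add: mat_rank_def)
qed

lemma grank_eq_max_matching: "grank S = max_matching (entry_arcs S)"
proof (rule antisym)
  show "grank S \<le> max_matching (entry_arcs S)"
    unfolding grank_def
    using finite_mat_rank_realizations realizations_nonempty mat_rank_le_max_matching
    by (subst Max_le_iff) auto
  obtain E where E: "E \<subseteq> entry_arcs S" "matching E" "card E = max_matching (entry_arcs S)"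
    using max_matching_attained[OF finite_entry_arcs] by blast
  let ?M = "mat (dim_row S) (dim_col S) (\<lambda>(k, l). if (l, k) \<in> E then 1 else 0 :: complex)"
  have "?M \<in> realizations S"
    using E(1) by (auto simp: realizations_def entry_arcs_def)
  then have "mat_rank ?M \<le> grank S"
    unfolding grank_def by (intro Max_ge finite_mat_rank_realizations imageI)
  moreover have "card E \<le> mat_rank ?M"
    unfolding mat_rank_def
    using rank_matching_ge[of E "dim_col S" "dim_row S"] E
    by (auto simp: entry_arcs_def)
  ultimately show "max_matching (entry_arcs S) \<le> grank S" using E(3) by simp
qed

lemma pick_bij_betw:
  assumes "finite I"
  shows "bij_betw (pick I) {..<card I} I"
proof -
  have mono: "strict_mono_on {..<card I} (pick I)"
    using pick_mono_le by (auto simp: strict_mono_on_def)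
  have inj: "inj_on (pick I) {..<card I}"
    using mono by (rule strict_mono_on_imp_inj_on)
  have "pick I ` {..<card I} \<subseteq> I"
    using pick_in_set_le by auto
  moreover have "card (pick I ` {..<card I}) = card I"
    using inj by (simp add: card_image)
  ultimately show ?thesis
    using inj assms by (simp add: bij_betw_def card_subset_eq)
qed

lemma grank_submatrix:
  assumes I: "I \<subseteq> {..<dim_row S}" and J: "J \<subseteq> {..<dim_col S}"
  shows "grank (submatrix S I J) = max_matching (entry_arcs S \<inter> J \<times> I)"
proof -
  let ?S = "submatrix S I J"
  have rows: "{k. k < dim_row S \<and> k \<in> I} = I" and cols: "{l. l < dim_col S \<and> l \<in> J} = J"
    using I J by auto
  have dims: "dim_row ?S = card I" "dim_col ?S = card J"
    by (simp_all only: dim_submatrix rows cols)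
  have bij: "bij_betw (pick I) {..<card I} I" "bij_betw (pick J) {..<card J} J"
    using I J finite_subset by (blast intro: pick_bij_betw)+
  have index: "?S $$ (k, l) = S $$ (pick I k, pick J l)" if "k < card I" "l < card J" for k l
    using that by (intro submatrix_index) (simp_all only: rows cols)
  have "map_prod (pick J) (pick I) ` entry_arcs ?S = entry_arcs S \<inter> J \<times> I"
  proof (intro equalityI subsetI)
    fix x assume "x \<in> map_prod (pick J) (pick I) ` entry_arcs ?S"
    then obtain l k where lk: "x = (pick J l, pick I k)" "(l, k) \<in> entry_arcs ?S"
      by auto
    then have "l < card J" "k < card I" "S $$ (pick I k, pick J l) \<noteq> Zero"
      by (auto simp: entry_arcs_def dims index)
    moreover from this have "pick I k \<in> I" "pick J l \<in> J"
      by (simp_all add: pick_in_set_le)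
    ultimately show "x \<in> entry_arcs S \<inter> J \<times> I"
      using lk(1) I J by (auto simp: entry_arcs_def)
  next
    fix x assume x: "x \<in> entry_arcs S \<inter> J \<times> I"
    then have "fst x \<in> pick J ` {..<card J}" "snd x \<in> pick I ` {..<card I}"
      using bij by (auto simp: bij_betw_def)
    then obtain l k where "fst x = pick J l" "l < card J" "snd x = pick I k" "k < card I"
      by blast
    then have lk: "x = (pick J l, pick I k)" "l < card J" "k < card I"
      by (simp_all add: prod_eq_iff)
    then have "(l, k) \<in> entry_arcs ?S"
      using x by (simp add: entry_arcs_def dims index)
    then show "x \<in> map_prod (pick J) (pick I) ` entry_arcs ?S"
      using lk(1) by (simp add: rev_image_eqI)
  qed
  moreover have "max_matching (map_prod (pick J) (pick I) ` entry_arcs ?S) = max_matching (entry_arcs ?S)"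
    using bij by (intro max_matching_map_prod)
      (auto simp: bij_betw_def entry_arcs_def dims intro: inj_on_subset)
  ultimately show ?thesis by (simp add: grank_eq_max_matching)
qed

section \<open>Rank of controllable pairs\<close>

lemma pow_mat_Suc_left:
  assumes "A \<in> carrier_mat n n"
  shows "A ^\<^sub>m Suc k = A * A ^\<^sub>m k"
  using assms
proof (induction k)
  case (Suc k)
  have "A ^\<^sub>m Suc (Suc k) = (A * A ^\<^sub>m k) * A"
    using Suc by simp
  also have "\<dots> = A * A ^\<^sub>m Suc k"
    using Suc.prems assoc_mult_mat[of A n n "A ^\<^sub>m k" n A n] by simp
  finally show ?case .
qed simp

text \<open>
  Each column \<open>A\<^sup>l b\<close> of the controllability matrix is either \<open>b\<close> or \<open>A\<close> times the preceding
  column. The controllability matrix therefore factors as \<open>[A, b] X\<close>; as it is invertible, the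
  columns of \<open>[A, b]\<close> span the whole space.
\<close>

lemma controllable_full_rank:
  assumes A: "A \<in> carrier_mat n n" and b: "b \<in> carrier_mat n 1" and ctrl: "controllable A b"
  shows "mat_rank (mat n (n + 1) (\<lambda>(k, l). if l < n then A $$ (k, l) else b $$ (k, 0))) = n"
    (is "mat_rank ?H = n")
proof -
  interpret vec_space "TYPE(complex)" n .
  let ?C = "controllability_matrix A b"
  \<comment> \<open>column \<open>l\<close> of \<open>X\<close> selects \<open>b\<close> if \<open>l = 0\<close>, and otherwise multiplies \<open>A\<close> by the preceding column\<close>
  let ?X = "mat (n + 1) n (\<lambda>(m, l). if l = 0 then of_bool (m = n)
    else if m < n then (A ^\<^sub>m (l - 1) * b) $$ (m, 0) else 0)"
  have C: "?C \<in> carrier_mat n n"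
    using A by (simp add: controllability_matrix_def)
  have "?C = ?H * ?X"
  proof (rule eq_matI)
    fix k l assume "k < dim_row (?H * ?X)" "l < dim_col (?H * ?X)"
    then have k: "k < n" and l: "l < n" by auto
    have "(?H * ?X) $$ (k, l) = (\<Sum>m<n + 1. ?H $$ (k, m) * ?X $$ (m, l))"
      using k l by (simp add: scalar_prod_def atLeast0LessThan)
    also have "\<dots> = (\<Sum>m<n. A $$ (k, m) * ?X $$ (m, l)) + b $$ (k, 0) * ?X $$ (n, l)"
      using k by simp
    also have "\<dots> = (A ^\<^sub>m l * b) $$ (k, 0)"
    proof (cases l)
      case 0
      then show ?thesis using A b k l by simp
    next
      case (Suc l')
      have "A ^\<^sub>m l * b = A * (A ^\<^sub>m l' * b)"
        unfolding Suc pow_mat_Suc_left[OF A] using A b by (simp add: assoc_mult_mat[of _ n n _ n _ 1])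
      then show ?thesis
        using A b k l Suc by (simp add: scalar_prod_def atLeast0LessThan del: pow_mat.simps)
    qed
    also have "\<dots> = ?C $$ (k, l)"
      using A k l by (simp add: controllability_matrix_def)
    finally show "?C $$ (k, l) = (?H * ?X) $$ (k, l)" ..
  qed (use C in auto)
  have "rank ?C = n"
    using ctrl C A by (simp add: controllable_def mat_rank_def)
  then have "det ?C \<noteq> 0"
    using det_rank_iff[OF C] by simp
  then obtain D where D: "D \<in> carrier_mat n n" "?C * D = 1\<^sub>m n"
    using det_non_zero_imp_unit[OF C, of undefined] by (auto simp: Units_def ring_mat_simps)
  have H: "?H \<in> carrier_mat n (n + 1)" and X: "?X \<in> carrier_mat (n + 1) n"
    by simp_all
  have "v \<in> span (set (cols ?H))" if v: "v \<in> carrier_vec n" for v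
  proof -
    have "v = (?C * D) *\<^sub>v v" using D v by simp
    also have "\<dots> = ?C *\<^sub>v (D *\<^sub>v v)"
      using C D(1) v by (rule assoc_mult_mat_vec)
    also have "\<dots> = ?H *\<^sub>v (?X *\<^sub>v (D *\<^sub>v v))"
      unfolding \<open>?C = ?H * ?X\<close>
      using H X mult_mat_vec_carrier[OF D(1) v] by (rule assoc_mult_mat_vec)
    finally have "?H *\<^sub>v (?X *\<^sub>v (D *\<^sub>v v)) = v" ..
    moreover have "?X *\<^sub>v (D *\<^sub>v v) \<in> carrier_vec (n + 1)"
      using X mult_mat_vec_carrier[OF D(1) v] by (rule mult_mat_vec_carrier)
    ultimately have "v \<in> col_space ?H"
      unfolding col_space_eq[OF H] using v by auto
    then show ?thesis by (simp only: col_space_def)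
  qed
  then have "span (set (cols ?H)) = carrier_vec n"
    using cols_dim[of ?H] by auto
  moreover have "vs (carrier_vec n) = V"
    by (simp add: module_vec_def)
  ultimately have "rank ?H = dim" by (simp only: rank_def)
  then show ?thesis using dim_is_n by (simp add: mat_rank_def)
qed

lemma structurally_controllable_max_matching:
  assumes A: "A \<in> carrier_mat n n" and b: "b \<in> carrier_mat n 1"
    and "structurally_controllable A b"
  shows "n \<le> max_matching (entry_arcs (sys_mat A b))"
proof -
  obtain A' b' where r: "A' \<in> realizations A" "b' \<in> realizations b" and c: "controllable A' b'"
    using assms(3) by (auto simp: structurally_controllable_def)
  let ?H = "mat n (n + 1) (\<lambda>(k, l). if l < n then A' $$ (k, l) else b' $$ (k, 0))"
  have "?H \<in> realizations (sys_mat A b)"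
    using A b r by (auto simp: realizations_def sys_mat_def)
  then have "mat_rank ?H \<le> max_matching (entry_arcs (sys_mat A b))"
    by (rule mat_rank_le_max_matching)
  moreover have "mat_rank ?H = n"
    using A b r c by (intro controllable_full_rank) (auto simp: realizations_def)
  ultimately show ?thesis by simp
qed

lemma arcs_sys_graph:
  assumes "A \<in> carrier_mat n n" and "b \<in> carrier_mat n 1"
  shows "arcs (sys_graph A b) = entry_arcs (sys_mat A b)"
  using assms by (auto simp: sys_graph_def entry_arcs_def sys_mat_def split: if_splits)

lemma max_family_size_del_arcs:
  "max_family_size (del_arcs (sys_graph A b) X) = max_matching (arcs (sys_graph A b) - X)"
proof -
  let ?G = "del_arcs (sys_graph A b) X"
  have "wf_digraph ?G"
    by unfold_locales (auto simp: del_arcs_def sys_graph_def)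
  moreover have "tail ?G = fst" "head ?G = snd" "arcs ?G = arcs (sys_graph A b) - X"
    by (simp_all add: del_arcs_def sys_graph_def)
  moreover have "finite (arcs (sys_graph A b) - X)"
    using finite_arcs_sys_graph by simp
  ultimately show ?thesis
    using wf_digraph.max_family_size_eq[of ?G] by (simp add: max_matching_def matching_def)
qed

theorem proposition7:
  fixes n i j :: nat and A b F :: "entry mat"
  assumes "A \<in> carrier_mat n n"
    and "b \<in> carrier_mat n 1"
    and "structurally_controllable A b"
    and "F \<in> carrier_mat n (n + 1)"
    and "i < n" and "j < n + 1"
    and "\<forall>k < n. \<forall>l < n + 1. F $$ (k, l) \<noteq> Zero \<longleftrightarrow> (k, l) = (i, j)"
  shows "i \<in> row_bases_star A b j \<longleftrightarrow>
    max_family_size (del_arcs (sys_graph A b) (out_arcs (sys_graph A b) j)) = n - 1 \<and>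
    max_family_size (del_arcs (sys_graph A b)
      (out_arcs (sys_graph A b) j \<union> in_arcs (sys_graph A b) i)) = n - 1"
proof -
  let ?R = "entry_arcs (sys_mat A b)"
  let ?J = "{..<n + 1} - {j}"
  have dims: "dim_row (sys_mat A b) = n" "dim_col (sys_mat A b) = n + 1"
    using assms(1) by (simp_all add: sys_mat_def)
  have dimA: "dim_row A = n" "dim_col A = n" using assms(1) by auto
  have arcs: "arcs (sys_graph A b) = ?R"
    using assms(1,2) by (rule arcs_sys_graph)
  have proj: "tail (sys_graph A b) = fst" "head (sys_graph A b) = snd"
    by (simp_all add: sys_graph_def)
  have sub: "grank (submatrix (sys_mat A b) I ?J) = max_matching (?R \<inter> ?J \<times> I)"
    if "I \<subseteq> {..<n}" for I
    using that by (intro grank_submatrix) (auto simp: dims)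
  let ?r = "max_matching (?R \<inter> ?J \<times> {..<n})"
  have r: "col_del_grank A b j = ?r"
    unfolding col_del_grank_def dimA by (rule sub) simp
  have bases: "I \<in> row_bases A b j \<longleftrightarrow>
      I \<subseteq> {..<n} \<and> max_matching (?R \<inter> ?J \<times> I) = ?r \<and> card I = ?r" for I
    unfolding row_bases_def r dimA using sub by auto
  have "?R - out_arcs (sys_graph A b) j = ?R \<inter> ?J \<times> {..<n}"
    by (auto simp: out_arcs_def arcs proj entry_arcs_def dims)
  then have G1: "max_family_size (del_arcs (sys_graph A b) (out_arcs (sys_graph A b) j)) = ?r"
    by (simp add: max_family_size_del_arcs arcs)
  have "?R - (out_arcs (sys_graph A b) j \<union> in_arcs (sys_graph A b) i) = ?R \<inter> ?J \<times> ({..<n} - {i})"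
    by (auto simp: out_arcs_def in_arcs_def arcs proj entry_arcs_def dims)
  then have G2: "max_family_size (del_arcs (sys_graph A b)
      (out_arcs (sys_graph A b) j \<union> in_arcs (sys_graph A b) i)) = max_matching (?R \<inter> ?J \<times> ({..<n} - {i}))"
    by (simp add: max_family_size_del_arcs arcs)
  have "{e \<in> ?R. fst e \<noteq> j} = ?R \<inter> ?J \<times> {..<n}"
    by (auto simp: entry_arcs_def dims)
  then have r_ge: "n - 1 \<le> ?r"
    using max_matching_remove_fst[OF finite_entry_arcs, of "sys_mat A b" j]
      structurally_controllable_max_matching[OF assms(1-3)] by simp
  have card: "card ({..<n} - {i}) = n - 1" using assms(5) by simp
  show ?thesis
    unfolding G1 G2
  proof
    assume "i \<in> row_bases_star A b j"
    then obtain I where "I \<in> row_bases A b j" and i: "i \<notin> I"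
      by (auto simp: row_bases_star_def)
    then have I: "I \<subseteq> {..<n}" "max_matching (?R \<inter> ?J \<times> I) = ?r" "card I = ?r"
      by (simp_all only: bases)
    \<comment> \<open>\<open>I\<close> has at least \<open>n - 1\<close> elements, the size of the set that contains it\<close>
    have "I = {..<n} - {i}"
      using I(1,3) i r_ge card by (intro card_seteq) auto
    then show "?r = n - 1 \<and> max_matching (?R \<inter> ?J \<times> ({..<n} - {i})) = n - 1"
      using I card by simp
  next
    assume "?r = n - 1 \<and> max_matching (?R \<inter> ?J \<times> ({..<n} - {i})) = n - 1"
    then have "{..<n} - {i} \<in> row_bases A b j"
      unfolding bases using card by auto
    then show "i \<in> row_bases_star A b j"
      using assms(5) by (auto simp: row_bases_star_def dimA)
  qed
qed

end
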